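(* Let $d\geq 2$, let $\xi\in\mathbb{C}$ with $\xi^2=-1$, let $p_{i,d-i}\in\mathbb{C}$ for $0\le i\le d$, let $P(x,y)=\sum_{i=0}^{d}p_{i,d-i}x^iy^{d-i}$ be a homogeneous polynomial of degree $d$, and let $$X=\xi(x\partial_x-y\partial_y)+P(x,y)\partial_x+\Big(\sum_{i=0}^{d}\overline{p_{d-i,i}}\,x^iy^{d-i}\Big)\partial_y,\qquad y=\bar x .$$ Assume that the coefficients of $P$ satisfy $$p_{0,d}=0,\qquad p_{i,d-i}=\overline{p_{d-i+1,i-1}}\quad (i=1,\dots,d).$$ Moreover, if $d$ is odd, $d=2m+1$, assume that $p_{m+1,m}=0$. Then the vector field $X$ is isochronous.
   Context: $X$ is the complex representation of a real planar polynomial vector field: the real plane is identified with $\{(x,y)\in\mathbb{C}^2: y=\bar x\}$, and the real dynamics is $\dot x=\xi x+P(x,\bar x)$ (the equation for $y=\bar x$ being its complex conjugate), with equilibrium at the origin. A vector field is said to be isochronous if all its (real) orbits in a neighbourhood of the equilibrium point are periodic with the same period. *)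

theory Defs
  imports "HOL-Analysis.Analysis"
begin

type_synonym vfield = "complex \<times> complex \<Rightarrow> complex \<times> complex"

text \<open>
  A planar real vector field in complex form is a field
  \<open>X = X\<^sub>1 \<partial>\<^sub>x + X\<^sub>2 \<partial>\<^sub>y\<close> on \<open>\<complex>\<^sup>2\<close>, given by its pair of components. The real
  dynamics is that of \<open>X\<close> on the following copy of the real plane, with real time.
\<close>

definition real_plane :: "(complex \<times> complex) set" where
  "real_plane = {(x, y). y = cnj x}"

text \<open>The values of \<open>\<gamma>\<close> outside the interval \<open>I\<close> of definition are irrelevant.\<close>

definition real_integral_curve ::
    "vfield \<Rightarrow> real set \<Rightarrow> (real \<Rightarrow> complex \<times> complex) \<Rightarrow> bool" where
  "real_integral_curve X I \<gamma> \<longleftrightarrow>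
     open I \<and> is_interval I \<and>
     (\<forall>t\<in>I. \<gamma> t \<in> real_plane \<and> (\<gamma> has_vector_derivative X (\<gamma> t)) (at t))"

definition maximal_real_integral_curve ::
    "vfield \<Rightarrow> real set \<Rightarrow> (real \<Rightarrow> complex \<times> complex) \<Rightarrow> bool" where
  "maximal_real_integral_curve X I \<gamma> \<longleftrightarrow>
     real_integral_curve X I \<gamma> \<and>
     (\<forall>J \<delta>. real_integral_curve X J \<delta> \<and> I \<subseteq> J \<and> (\<forall>t\<in>I. \<delta> t = \<gamma> t) \<longrightarrow> J = I)"

definition has_least_period :: "(real \<Rightarrow> 'a) \<Rightarrow> real \<Rightarrow> bool" where
  "has_least_period \<gamma> T \<longleftrightarrow>
     T > 0 \<and> (\<forall>t. \<gamma> (t + T) = \<gamma> t) \<and>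
     (\<forall>S. 0 < S \<and> S < T \<longrightarrow> \<not> (\<forall>t. \<gamma> (t + S) = \<gamma> t))"

text \<open>
  The equilibrium point is the origin; its own constant orbit is excluded. Every real
  orbit through a nearby point must be defined for all times and have least period \<open>T\<close>,
  with \<open>T\<close> independent of the orbit. The existence conjunct keeps the universal
  one from holding vacuously for fields without integral curves.
\<close>

definition isochronous :: "vfield \<Rightarrow> bool" where
  "isochronous X \<longleftrightarrow>
     X (0, 0) = (0, 0) \<and>
     (\<exists>T U. open U \<and> (0, 0) \<in> U \<and>
        (\<forall>z \<in> U \<inter> real_plane - {(0, 0)}.
           (\<exists>I \<gamma>. maximal_real_integral_curve X I \<gamma> \<and> 0 \<in> I \<and> \<gamma> 0 = z) \<and>
           (\<forall>I \<gamma>. maximal_real_integral_curve X I \<gamma> \<and> 0 \<in> I \<and> \<gamma> 0 = z \<longrightarrow>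
              I = UNIV \<and> has_least_period \<gamma> T)))"

text \<open>
  The field
  \<open>\<xi> (x \<partial>\<^sub>x - y \<partial>\<^sub>y) + P(x,y) \<partial>\<^sub>x + (\<Sum>i=0..d. cnj (p (d-i) i) x^i y^(d-i)) \<partial>\<^sub>y\<close>,
  where \<open>P(x,y) = (\<Sum>i=0..d. p i (d-i) x^i y^(d-i))\<close>. Only the values \<open>p i j\<close> with
  \<open>i + j = d\<close> are used.
\<close>

definition hom_perturbation ::
    "complex \<Rightarrow> nat \<Rightarrow> (nat \<Rightarrow> nat \<Rightarrow> complex) \<Rightarrow> vfield" where
  "hom_perturbation \<xi> d p = (\<lambda>(x, y).
     (\<xi> * x + (\<Sum>i=0..d. p i (d - i) * x ^ i * y ^ (d - i)),
      - \<xi> * y + (\<Sum>i=0..d. cnj (p (d - i) i) * x ^ i * y ^ (d - i))))"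

end

theory Submission
  imports Defs
begin

text \<open>
  The symmetry of the coefficients says exactly that \<open>P(x, cnj x) = x * Q x\<close> with \<open>Q\<close>
  real-valued and homogeneous of degree \<open>n = d - 1\<close>. On the real plane the equation is
  therefore \<open>x' = x * (\<xi> + Q x)\<close> with \<open>\<xi> = \<plusminus>\<i>\<close>: the angle moves at constant speed one,
  and only the radius feels the perturbation. In the rotating frame
  \<open>x t = exp (\<xi> t) * x0 * r t\<close> the equation becomes the Bernoulli equation
  \<open>r' = r^d * Q (exp (\<xi> t) * x0)\<close>, whose solution with \<open>r 0 = 1\<close> is \<open>(1 - n * H t) powr (- 1 / n)\<close>,
  where \<open>H\<close> is the primitive of \<open>Q (exp (\<xi> t) * x0)\<close> that vanishes at \<open>0\<close>. An orbit thus has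
  period \<open>2 * pi\<close> as soon as \<open>H\<close> does and \<open>n * H\<close> stays below \<open>1\<close>.

  Now \<open>Q (exp (\<xi> t) * x0)\<close> is a trigonometric polynomial with frequencies \<open>2 * j - n\<close>, so \<open>H\<close> is
  periodic if and only if the coefficient of frequency zero vanishes. This is automatic for odd \<open>n\<close>,
  and for \<open>n = 2 * m\<close> it is the hypothesis on the coefficient with indices \<open>m + 1\<close> and \<open>m\<close>.
  Since \<open>H\<close> is of size \<open>O(norm x0 ^ n)\<close>, the bound \<open>n * H < 1\<close> holds near the origin.

  The analytic half of the argument is \<open>isochronous_if_periodic_primitive\<close>, the
  trigonometric half \<open>homogeneous_form_periodic_primitive\<close>.
\<close>

section \<open>Planar fields with constant angular speed\<close>

lemma square_eq_minus_one_cases: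
  fixes \<xi> :: complex
  assumes "\<xi>\<^sup>2 = -1"
  shows "\<xi> = \<i> \<or> \<xi> = -\<i>"
  using assms by (metis power2_eq_iff power2_i)

lemma has_vector_derivative_rotation:
  fixes \<xi> :: complex
  shows "((\<lambda>t. exp (\<xi> * of_real t)) has_vector_derivative \<xi> * exp (\<xi> * of_real t)) (at t within S)"
  by (rule has_vector_derivative_real_field) (auto intro!: derivative_eq_intros)

text \<open>
  The radial factor solves \<open>r' = r * (r^n * Q (exp (\<xi> t) * x0))\<close>, and homogeneity absorbs \<open>r^n\<close> into
  the argument of \<open>Q\<close>.
\<close>

lemma uniformly_rotating_curve:
  fixes \<xi> x0 :: complex and Q :: "complex \<Rightarrow> real" and H :: "real \<Rightarrow> real" and n :: nat
  assumes "n > 0"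
    and hom: "\<And>r x. r > 0 \<Longrightarrow> Q (of_real r * x) = r ^ n * Q x"
    and H: "\<And>t. (H has_real_derivative Q (exp (\<xi> * of_real t) * x0)) (at t)"
    and below: "\<And>t. n * H t < 1"
  defines "\<phi> \<equiv> \<lambda>t. exp (\<xi> * of_real t) * x0 * of_real ((1 - n * H t) powr (- 1 / n))"
  shows "(\<phi> has_vector_derivative \<phi> t * (\<xi> + Q (\<phi> t))) (at t)"
proof -
  define r where "r = (\<lambda>t. (1 - n * H t) powr (- 1 / n))"
  define e where "e = (\<lambda>t. exp (\<xi> * of_real t))"
  have r_pos: "r t > 0" using below[of t] by (simp add: r_def)
  have exponent: "(1 - n * H t) powr (- 1 / n - 1) = r t * r t ^ n"
  proof -
    have "r t ^ n = (1 - n * H t) powr (- 1)"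
      using \<open>n > 0\<close> below[of t] by (simp add: r_def powr_realpow[symmetric] powr_powr)
    moreover have "(1 - n * H t) powr (- 1 / n - 1) = r t * (1 - n * H t) powr (- 1)"
      unfolding r_def powr_add[symmetric] by simp
    ultimately show ?thesis
      by simp
  qed
  have "(r has_real_derivative (- 1 / n) * (1 - n * H t) powr (- 1 / n - 1) * (- (n * Q (e t * x0)))) (at t)"
    unfolding r_def e_def
    using below[of t] by (auto intro!: derivative_eq_intros H)
  also have "(- 1 / n) * (1 - n * H t) powr (- 1 / n - 1) * (- (n * Q (e t * x0))) = r t * (r t ^ n * Q (e t * x0))"
    unfolding exponent using \<open>n > 0\<close> by simp
  also have "\<dots> = r t * Q (\<phi> t)"
    using hom[OF r_pos, of "e t * x0"] by (simp add: \<phi>_def r_def e_def mult_ac)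
  finally have r': "((\<lambda>t. complex_of_real (r t)) has_vector_derivative of_real (r t * Q (\<phi> t))) (at t)"
    by (metis has_real_derivative_iff_has_vector_derivative has_vector_derivative_of_real)
  have "((\<lambda>t. e t * x0 * of_real (r t)) has_vector_derivative
         e t * x0 * of_real (r t * Q (\<phi> t)) + \<xi> * e t * x0 * of_real (r t)) (at t)"
    unfolding e_def
    by (intro has_vector_derivative_mult has_vector_derivative_mult_left has_vector_derivative_rotation
        r'[unfolded e_def])
  moreover have "\<phi> = (\<lambda>t. e t * x0 * of_real (r t))"
    by (simp add: \<phi>_def e_def r_def)
  ultimately show ?thesis
    by (simp add: algebra_simps)
qed

text \<open>
  Uniqueness is obtained by integrating the equation rather than from a Lipschitz
  estimate. Along any solution the real function \<open>Q (x s)\<close> has a primitive \<open>A\<close> with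
  \<open>A 0 = 0\<close>, and the linear equation \<open>x' = x * (\<xi> + A')\<close> forces
  \<open>x s = exp (\<xi> s) * x0 * exp (A s)\<close>. Because \<open>exp (A s)\<close> is positive, homogeneity turns \<open>A'\<close> into
  \<open>exp (n * A) * H'\<close>, so that \<open>exp (- n * A) + n * H\<close> is constant, which determines \<open>A\<close>. The bound
  \<open>n * H t < 1\<close> needed for the power comes out as a by-product, since
  \<open>1 - n * H t = exp (- n * A t)\<close>.
\<close>

lemma uniformly_rotating_curve_unique:
  fixes \<xi> x0 :: complex and Q :: "complex \<Rightarrow> real" and H :: "real \<Rightarrow> real" and n :: nat
  assumes "n > 0"
    and cont: "continuous_on UNIV Q"
    and hom: "\<And>r x. r > 0 \<Longrightarrow> Q (of_real r * x) = r ^ n * Q x"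
    and H: "\<And>t. (H has_real_derivative Q (exp (\<xi> * of_real t) * x0)) (at t)"
    and "H 0 = 0"
    and I: "is_interval I" "0 \<in> I" "t \<in> I"
    and x: "\<And>s. s \<in> I \<Longrightarrow> (x has_vector_derivative x s * (\<xi> + Q (x s))) (at s)"
    and "x 0 = x0"
  shows "x t = exp (\<xi> * of_real t) * x0 * of_real ((1 - n * H t) powr (- 1 / n))"
proof -
  \<comment> \<open>A compact interval, so that the continuous function \<open>Q (x s)\<close> has a primitive on it.\<close>
  define J where "J = closed_segment 0 t"
  have J: "J \<subseteq> I" "convex J" "0 \<in> J" "t \<in> J"
    using I by (auto simp: J_def closed_segment_subset is_interval_convex_1)
  obtain a b where ab: "J = {a..b}"
    unfolding J_def by (metis closed_segment_eq_real_ivl)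
  have x_J: "(x has_vector_derivative x s * (\<xi> + Q (x s))) (at s within J)" if "s \<in> J" for s
    using x J that has_vector_derivative_at_within by blast
  have "continuous_on J x"
    using x_J by (meson continuous_on_eq_continuous_within has_vector_derivative_continuous)
  then have "continuous_on J (\<lambda>s. Q (x s))"
    by (intro continuous_on_compose2[OF cont]) auto
  then obtain B where B: "\<And>s. s \<in> J \<Longrightarrow> (B has_vector_derivative Q (x s)) (at s within J)"
    unfolding ab using antiderivative_continuous by blast
  define A where "A = (\<lambda>s. B s - B 0)"
  have A: "(A has_vector_derivative Q (x s)) (at s within J)" if "s \<in> J" for s
    unfolding A_def using B[OF that] by (auto intro!: derivative_eq_intros)
  have A_real: "(A has_real_derivative Q (x s)) (at s within J)" if "s \<in> J" for s
    using A[OF that] by (simp add: has_real_derivative_iff_has_vector_derivative)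
  have expA: "((\<lambda>s. complex_of_real (exp (- A s))) has_vector_derivative
      of_real (- Q (x s) * exp (- A s))) (at s within J)" if "s \<in> J" for s
  proof (rule has_vector_derivative_of_real)
    show "((\<lambda>s. exp (- A s)) has_real_derivative - Q (x s) * exp (- A s)) (at s within J)"
      by (auto intro!: derivative_eq_intros A_real that)
  qed
  have "((\<lambda>s. exp (- \<xi> * of_real s) * x s * of_real (exp (- A s))) has_vector_derivative 0) (at s within J)"
    if s: "s \<in> J" for s
  proof -
    have "((\<lambda>s. exp (- \<xi> * of_real s) * x s * of_real (exp (- A s))) has_vector_derivative
       exp (- \<xi> * of_real s) * x s * of_real (- Q (x s) * exp (- A s)) +
       (exp (- \<xi> * of_real s) * (x s * (\<xi> + Q (x s))) + - \<xi> * exp (- \<xi> * of_real s) * x s)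
         * of_real (exp (- A s))) (at s within J)"
      by (intro has_vector_derivative_mult has_vector_derivative_rotation x_J expA s)
    then show ?thesis
      by (simp add: algebra_simps)
  qed
  then obtain c where c: "\<And>s. s \<in> J \<Longrightarrow> exp (- \<xi> * of_real s) * x s * of_real (exp (- A s)) = c"
    using has_vector_derivative_zero_constant[OF J(2)] by blast
  have "c = x0"
    using c[OF J(3)] \<open>x 0 = x0\<close> by (simp add: A_def)
  have x_eq: "x s = exp (\<xi> * of_real s) * x0 * of_real (exp (A s))" if "s \<in> J" for s
  proof -
    have "exp (\<xi> * of_real s) * x0 * of_real (exp (A s))
       = (exp (\<xi> * of_real s) * exp (- \<xi> * of_real s)) * x s * of_real (exp (- A s) * exp (A s))"
      using c[OF that] \<open>c = x0\<close> by (simp add: mult_ac)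
    then show ?thesis
      by (simp add: exp_minus)
  qed
  have "((\<lambda>s. exp (- n * A s) + n * H s) has_vector_derivative 0) (at s within J)" if s: "s \<in> J" for s
  proof -
    have "Q (x s) = exp (n * A s) * Q (exp (\<xi> * of_real s) * x0)"
      using hom[of "exp (A s)" "exp (\<xi> * of_real s) * x0"] x_eq[OF s]
      by (simp add: mult_ac flip: exp_of_nat_mult)
    moreover have "((\<lambda>s. exp (- n * A s) + n * H s) has_real_derivative
        - n * Q (x s) * exp (- n * A s) + n * Q (exp (\<xi> * of_real s) * x0)) (at s within J)"
      by (auto intro!: derivative_eq_intros A_real s has_field_derivative_at_within[OF H])
    moreover have "- n * Q (x s) * exp (- n * A s) + n * Q (exp (\<xi> * of_real s) * x0) = 0"
      unfolding calculation(1) by (simp add: exp_minus)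
    ultimately show ?thesis
      by (simp only: has_real_derivative_iff_has_vector_derivative)
  qed
  then obtain k where "\<And>s. s \<in> J \<Longrightarrow> exp (- n * A s) + n * H s = k"
    using has_vector_derivative_zero_constant[OF J(2)] by blast
  from this[OF J(3)] this[OF J(4)] have "1 - n * H t = exp (- n * A t)"
    using \<open>H 0 = 0\<close> by (simp add: A_def)
  then have "(1 - n * H t) powr (- 1 / n) = exp (A t)"
    using \<open>n > 0\<close> by (simp add: powr_def)
  then show ?thesis
    using x_eq[OF J(4)] by simp
qed

text \<open>
  By uniqueness every maximal curve is the restriction of the global explicit one, and hence
  equal to it. Its period \<open>2 * pi\<close> is least because the radial factor is positive: a
  return to the initial point forces the rotation alone to return.
\<close>

lemma isochronous_if_periodic_primitive:
  fixes \<xi> :: complex and Q :: "complex \<Rightarrow> real" and n :: nat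
  assumes \<xi>: "\<xi>\<^sup>2 = -1" and "n > 0"
    and cont: "continuous_on UNIV Q"
    and hom: "\<And>r x. r > 0 \<Longrightarrow> Q (of_real r * x) = r ^ n * Q x"
    and X: "\<And>x. X (x, cnj x) = (x * (\<xi> + Q x), cnj (x * (\<xi> + Q x)))"
    and V: "open V" "0 \<in> V"
    and primitive: "\<And>x. x \<in> V \<Longrightarrow> \<exists>H. H 0 = 0 \<and>
        (\<forall>t. (H has_real_derivative Q (exp (\<xi> * of_real t) * x)) (at t)) \<and>
        (\<forall>t. H (t + 2 * pi) = H t) \<and> (\<forall>t. real n * H t < 1)"
  shows "isochronous X"
proof -
  have orbit: "(\<exists>I \<gamma>. maximal_real_integral_curve X I \<gamma> \<and> 0 \<in> I \<and> \<gamma> 0 = (x0, cnj x0)) \<and>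
      (\<forall>I \<gamma>. maximal_real_integral_curve X I \<gamma> \<and> 0 \<in> I \<and> \<gamma> 0 = (x0, cnj x0) \<longrightarrow>
          I = UNIV \<and> has_least_period \<gamma> (2 * pi))"
    if "x0 \<in> V" "x0 \<noteq> 0" for x0
  proof -
    obtain H :: "real \<Rightarrow> real" where H: "H 0 = 0" "\<And>t. (H has_real_derivative Q (exp (\<xi> * of_real t) * x0)) (at t)"
       "\<And>t. H (t + 2 * pi) = H t" "\<And>t. n * H t < 1"
      using primitive[OF \<open>x0 \<in> V\<close>] by blast
    define r where "r = (\<lambda>t. (1 - n * H t) powr (- 1 / n))"
    define \<phi> where "\<phi> = (\<lambda>t. exp (\<xi> * of_real t) * x0 * of_real (r t))"
    define \<Phi> where "\<Phi> = (\<lambda>t. (\<phi> t, cnj (\<phi> t)))"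
    have "\<phi> 0 = x0"
      by (simp add: \<phi>_def r_def H(1))
    have "(\<phi> has_vector_derivative \<phi> t * (\<xi> + Q (\<phi> t))) (at t)" for t
      unfolding \<phi>_def r_def
      by (rule uniformly_rotating_curve[OF \<open>n > 0\<close> hom H(2) H(4)])
    then have "(\<Phi> has_vector_derivative X (\<Phi> t)) (at t)" for t
      unfolding \<Phi>_def X
      by (intro has_vector_derivative_Pair has_vector_derivative_cnj)
    then have curve: "real_integral_curve X UNIV \<Phi>"
      by (simp add: real_integral_curve_def real_plane_def \<Phi>_def)
    then have "maximal_real_integral_curve X UNIV \<Phi>"
      by (auto simp: maximal_real_integral_curve_def)
    moreover have "\<Phi> 0 = (x0, cnj x0)"
      using \<open>\<phi> 0 = x0\<close> by (simp add: \<Phi>_def)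
    moreover have "I = UNIV \<and> has_least_period \<gamma> (2 * pi)"
      if max: "maximal_real_integral_curve X I \<gamma>" and "0 \<in> I" "\<gamma> 0 = (x0, cnj x0)" for I \<gamma>
    proof -
      have I: "is_interval I"
        and \<gamma>: "\<And>s. s \<in> I \<Longrightarrow> \<gamma> s \<in> real_plane"
               "\<And>s. s \<in> I \<Longrightarrow> (\<gamma> has_vector_derivative X (\<gamma> s)) (at s)"
        using max by (auto simp: maximal_real_integral_curve_def real_integral_curve_def)
      have \<gamma>_eq: "\<gamma> s = (fst (\<gamma> s), cnj (fst (\<gamma> s)))" if "s \<in> I" for s
        using \<gamma>(1)[OF that] by (auto simp: real_plane_def)
      have "((\<lambda>s. fst (\<gamma> s)) has_vector_derivative fst (\<gamma> s) * (\<xi> + Q (fst (\<gamma> s)))) (at s)"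
        if "s \<in> I" for s
      proof -
        have "((\<lambda>s. fst (\<gamma> s)) has_vector_derivative fst (X (\<gamma> s))) (at s)"
          using \<gamma>(2)[OF that] by (rule bounded_linear.has_vector_derivative[OF bounded_linear_fst])
        moreover have "fst (X (\<gamma> s)) = fst (\<gamma> s) * (\<xi> + Q (fst (\<gamma> s)))"
          by (subst \<gamma>_eq[OF that]) (simp add: X)
        ultimately show ?thesis
          by simp
      qed
      then have "fst (\<gamma> t) = \<phi> t" if "t \<in> I" for t
        unfolding \<phi>_def r_def
        using \<open>\<gamma> 0 = (x0, cnj x0)\<close>
        by (intro uniformly_rotating_curve_unique[OF \<open>n > 0\<close> cont hom H(2,1) I \<open>0 \<in> I\<close> that]) auto
      then have agree: "\<gamma> t = \<Phi> t" if "t \<in> I" for t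
        using \<gamma>_eq[OF that] that by (simp add: \<Phi>_def)
      then have "I = UNIV"
        using max curve unfolding maximal_real_integral_curve_def by (metis subset_UNIV)
      then have "\<gamma> = \<Phi>"
        using agree by auto
      have "has_least_period \<Phi> (2 * pi)"
        unfolding has_least_period_def
      proof (intro conjI allI impI)
        have "exp (\<xi> * of_real (2 * pi)) = 1"
          using square_eq_minus_one_cases[OF \<xi>] by (auto simp: exp_eq_1 intro: exI[of _ "-1"] exI[of _ "1"])
        then have "exp (\<xi> * of_real (t + 2 * pi)) = exp (\<xi> * of_real t)" for t
          by (simp add: distrib_left exp_add)
        then show "\<Phi> (t + 2 * pi) = \<Phi> t" for t
          by (simp add: \<Phi>_def \<phi>_def r_def H(3))
      next
        fix S
        assume S: "0 < S \<and> S < 2 * pi"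
        show "\<not> (\<forall>t. \<Phi> (t + S) = \<Phi> t)"
        proof
          assume "\<forall>t. \<Phi> (t + S) = \<Phi> t"
          then have "\<Phi> (0 + S) = \<Phi> 0"
            by blast
          then have "\<phi> S = \<phi> 0"
            by (simp add: \<Phi>_def)
          then have e: "exp (\<xi> * of_real S) * of_real (r S) = 1"
            using \<open>\<phi> 0 = x0\<close> \<open>x0 \<noteq> 0\<close> by (simp add: \<phi>_def)
          have "r S \<ge> 0"
            by (simp add: r_def)
          moreover have "norm (exp (\<xi> * of_real S)) = 1"
            using square_eq_minus_one_cases[OF \<xi>] by auto
          \<comment> \<open>Taking norms in \<open>e\<close> separates the radial factor from the rotation.\<close>
          ultimately have "r S = 1"
            using arg_cong[OF e, of norm] by (simp add: norm_mult del: norm_exp_eq_Re)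
          then have "exp (\<xi> * of_real S) = 1"
            using e by simp
          then obtain k :: int where "\<bar>S\<bar> = \<bar>real_of_int (2 * k) * pi\<bar>"
            using square_eq_minus_one_cases[OF \<xi>] by (auto simp: exp_eq_1) (metis abs_minus_cancel)
          then have "S = real_of_int \<bar>k\<bar> * (2 * pi)"
            using S by (simp add: abs_mult)
          moreover from this S have "\<bar>k\<bar> < 1" "0 < \<bar>k\<bar>"
            by (auto simp: zero_less_mult_iff)
          ultimately show False
            by simp
        qed
      qed simp
      then show ?thesis
        using \<open>I = UNIV\<close> \<open>\<gamma> = \<Phi>\<close> by simp
    qed
    ultimately show ?thesis
      by blast
  qed
  show ?thesis
    unfolding isochronous_def
  proof (intro conjI exI[of _ "2 * pi"] exI[of _ "V \<times> (UNIV :: complex set)"])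
    show "X (0, 0) = (0, 0)"
      using X[of 0] by simp
    show "\<forall>z \<in> V \<times> UNIV \<inter> real_plane - {(0, 0)}.
       (\<exists>I \<gamma>. maximal_real_integral_curve X I \<gamma> \<and> 0 \<in> I \<and> \<gamma> 0 = z) \<and>
       (\<forall>I \<gamma>. maximal_real_integral_curve X I \<gamma> \<and> 0 \<in> I \<and> \<gamma> 0 = z \<longrightarrow>
          I = UNIV \<and> has_least_period \<gamma> (2 * pi))"
    proof
      fix z
      assume "z \<in> V \<times> UNIV \<inter> real_plane - {(0, 0)}"
      then obtain x where z: "z = (x, cnj x)" "x \<in> V" "x \<noteq> 0"
        by (auto simp: real_plane_def)
      show "(\<exists>I \<gamma>. maximal_real_integral_curve X I \<gamma> \<and> 0 \<in> I \<and> \<gamma> 0 = z) \<and>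
       (\<forall>I \<gamma>. maximal_real_integral_curve X I \<gamma> \<and> 0 \<in> I \<and> \<gamma> 0 = z \<longrightarrow>
          I = UNIV \<and> has_least_period \<gamma> (2 * pi))"
        unfolding z(1) by (rule orbit[OF z(2,3)])
    qed
  qed (use V in \<open>auto intro: open_Times\<close>)
qed

section \<open>Real homogeneous forms along the unperturbed rotation\<close>

definition homogeneous_form :: "nat \<Rightarrow> (nat \<Rightarrow> complex) \<Rightarrow> complex \<Rightarrow> complex" where
  "homogeneous_form n q x = (\<Sum>j\<le>n. q j * x ^ j * cnj x ^ (n - j))"

lemma homogeneous_form_scale:
  "homogeneous_form n q (of_real r * x) = of_real (r ^ n) * homogeneous_form n q x"
proof -
  have "complex_of_real r ^ j * of_real r ^ (n - j) = of_real r ^ n" if "j \<le> n" for j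
    using that by (simp flip: power_add)
  then show ?thesis
    unfolding homogeneous_form_def sum_distrib_left
    by (intro sum.cong) (auto simp: power_mult_distrib mult_ac)
qed

lemma homogeneous_form_real:
  assumes "\<And>j. j \<le> n \<Longrightarrow> q j = cnj (q (n - j))"
  shows "of_real (Re (homogeneous_form n q x)) = homogeneous_form n q x"
proof -
  have "cnj (homogeneous_form n q x) = (\<Sum>j\<le>n. cnj (q j) * cnj x ^ j * x ^ (n - j))"
    by (simp add: homogeneous_form_def)
  also have "\<dots> = (\<Sum>j\<le>n. cnj (q (n - j)) * cnj x ^ (n - j) * x ^ (n - (n - j)))"
    by (rule sum.reindex_bij_witness[of _ "\<lambda>j. n - j" "\<lambda>j. n - j"]) auto
  also have "\<dots> = homogeneous_form n q x"
    unfolding homogeneous_form_def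
  proof (intro sum.cong refl)
    fix j
    assume "j \<in> {..n}"
    then show "cnj (q (n - j)) * cnj x ^ (n - j) * x ^ (n - (n - j)) = q j * x ^ j * cnj x ^ (n - j)"
      using assms[of j] by simp
  qed
  finally show ?thesis
    by (metis Reals_cnj_iff of_real_Re)
qed

text \<open>
  Along the rotation the \<open>j\<close>-th monomial is a multiple of \<open>exp (\<omega> j * t)\<close> with
  \<open>\<omega> j = \<xi> * (2 * j - n)\<close>, so termwise integration gives a primitive. The nonzero frequencies are
  integers times \<open>\<xi>\<close>, which yields both the period \<open>2 * pi\<close> and, from
  \<open>norm (\<omega> j) \<ge> 1\<close>, the bound.
\<close>

lemma homogeneous_form_periodic_primitive:
  fixes \<xi> :: complex
  assumes \<xi>: "\<xi>\<^sup>2 = -1" and mean: "\<And>j. 2 * j = n \<Longrightarrow> q j = 0"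
  shows "\<exists>H. H 0 = 0 \<and>
        (\<forall>t. (H has_real_derivative Re (homogeneous_form n q (exp (\<xi> * of_real t) * x))) (at t)) \<and>
        (\<forall>t. H (t + 2 * pi) = H t) \<and> (\<forall>t. \<bar>H t\<bar> \<le> 2 * (\<Sum>j\<le>n. norm (q j)) * norm x ^ n)"
proof -
  define \<omega> where "\<omega> = (\<lambda>j. \<xi> * (2 * of_nat j - of_nat n))"
  define c where "c = (\<lambda>j. q j * x ^ j * cnj x ^ (n - j))"
  \<comment> \<open>A term with \<open>\<omega> j = 0\<close> is zero here by division by zero, in accordance with its coefficient.\<close>
  define F where "F = (\<lambda>t. \<Sum>j\<le>n. c j * ((exp (\<omega> j * of_real t) - 1) / \<omega> j))"
  have \<xi>_cases: "\<xi> = \<i> \<or> \<xi> = - \<i>"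
    using square_eq_minus_one_cases[OF \<xi>] .
  then have \<xi>_props: "\<xi> \<noteq> 0" "cnj \<xi> = - \<xi>" "norm \<xi> = 1"
    by auto
  have form: "homogeneous_form n q (exp (\<xi> * of_real t) * x) = (\<Sum>j\<le>n. c j * exp (\<omega> j * of_real t))" for t
    unfolding homogeneous_form_def
  proof (intro sum.cong refl)
    fix j
    assume "j \<in> {..n}"
    then have "\<omega> j = of_nat j * \<xi> + of_nat (n - j) * - \<xi>"
      by (simp add: \<omega>_def of_nat_diff algebra_simps)
    then have "\<omega> j * of_real t = of_nat j * (\<xi> * of_real t) + of_nat (n - j) * (- \<xi> * of_real t)"
      by (simp only: distrib_right mult.assoc)
    then have "exp (\<omega> j * of_real t) = exp (\<xi> * of_real t) ^ j * exp (- \<xi> * of_real t) ^ (n - j)"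
      by (simp only: exp_add exp_of_nat_mult)
    moreover have "cnj (exp (\<xi> * of_real t)) = exp (- \<xi> * of_real t)"
      by (simp add: exp_cnj \<xi>_props(2))
    ultimately show "q j * (exp (\<xi> * of_real t) * x) ^ j * cnj (exp (\<xi> * of_real t) * x) ^ (n - j)
        = c j * exp (\<omega> j * of_real t)"
      by (simp add: c_def power_mult_distrib mult_ac)
  qed
  have resonance: "q j = 0" if "\<omega> j = 0" for j
  proof -
    have "complex_of_nat (2 * j) = of_nat n"
      using that \<xi>_props(1) by (simp add: \<omega>_def)
    then show ?thesis
      using mean[of j] of_nat_eq_iff by blast
  qed
  have F': "(F has_vector_derivative homogeneous_form n q (exp (\<xi> * of_real t) * x)) (at t)" for t
    unfolding F_def form
  proof (rule has_vector_derivative_sum)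
    fix j
    show "((\<lambda>t. c j * ((exp (\<omega> j * of_real t) - 1) / \<omega> j)) has_vector_derivative
        c j * exp (\<omega> j * of_real t)) (at t)"
    proof (cases "\<omega> j = 0")
      case True
      then show ?thesis
        by (simp add: c_def resonance)
    next
      case False
      then show ?thesis
        by (intro has_vector_derivative_real_field) (auto intro!: derivative_eq_intros)
    qed
  qed
  have "((\<lambda>t. Re (F t)) has_real_derivative Re (homogeneous_form n q (exp (\<xi> * of_real t) * x))) (at t)" for t
    using bounded_linear.has_vector_derivative[OF bounded_linear_Re F']
    by (simp add: has_real_derivative_iff_has_vector_derivative)
  moreover have "F (t + 2 * pi) = F t" for t
  proof -
    have "exp (\<omega> j * of_real (2 * pi)) = 1" for j
    proof -
      have "exp (\<i> * (2 * of_nat j - of_nat n) * of_real (2 * pi)) = 1"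
        unfolding exp_eq_1 by (auto intro!: exI[of _ "2 * int j - int n"])
      moreover have "exp (- \<i> * (2 * of_nat j - of_nat n) * of_real (2 * pi)) = 1"
        unfolding exp_eq_1 by (auto intro!: exI[of _ "int n - 2 * int j"] simp: algebra_simps)
      ultimately show ?thesis
        using \<xi>_cases by (auto simp: \<omega>_def)
    qed
    then show ?thesis
      by (simp add: F_def distrib_left exp_add)
  qed
  moreover have "\<bar>Re (F t)\<bar> \<le> 2 * (\<Sum>j\<le>n. norm (q j)) * norm x ^ n" for t
  proof -
    have summand: "norm (c j * ((exp (\<omega> j * of_real t) - 1) / \<omega> j)) \<le> 2 * norm (q j) * norm x ^ n"
      if "j \<le> n" for j
    proof (cases "\<omega> j = 0")
      case False
      have "norm (exp (\<omega> j * of_real t)) = 1"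
        using \<xi>_cases by (auto simp: \<omega>_def)
      then have num: "norm (exp (\<omega> j * of_real t) - 1) \<le> 2"
        using norm_triangle_ineq4[of "exp (\<omega> j * of_real t)" 1]
        by (simp del: norm_exp_eq_Re)
      have "\<omega> j = \<xi> * of_int (2 * int j - int n)"
        by (simp add: \<omega>_def)
      moreover from this False have "2 * int j - int n \<noteq> 0"
        by (metis mult_zero_right of_int_0)
      then have "1 \<le> \<bar>real_of_int (2 * int j - int n)\<bar>"
        by linarith
      ultimately have den: "norm (\<omega> j) \<ge> 1"
        by (simp only: norm_mult \<xi>_props(3) norm_of_int mult_1)
      have "norm ((exp (\<omega> j * of_real t) - 1) / \<omega> j) \<le> 2 / 1"
        unfolding norm_divide by (rule frac_le) (use num den in auto)
      moreover have "norm (c j) = norm (q j) * norm x ^ n"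
        using that by (simp add: c_def norm_mult norm_power mult.assoc flip: power_add)
      ultimately show ?thesis
        using mult_left_mono[of "norm ((exp (\<omega> j * of_real t) - 1) / \<omega> j)" 2 "norm (c j)"]
        unfolding norm_mult[of "c j"] by (simp add: mult_ac)
    qed simp
    have "\<bar>Re (F t)\<bar> \<le> norm (F t)"
      by (rule abs_Re_le_cmod)
    also have "\<dots> \<le> (\<Sum>j\<le>n. 2 * norm (q j) * norm x ^ n)"
      unfolding F_def by (intro sum_norm_le summand) simp
    also have "\<dots> = 2 * (\<Sum>j\<le>n. norm (q j)) * norm x ^ n"
      by (simp add: sum_distrib_left sum_distrib_right)
    finally show ?thesis .
  qed
  moreover have "Re (F 0) = 0"
    by (simp add: F_def)
  ultimately show ?thesis
    by (intro exI[of _ "\<lambda>t. Re (F t)"]) auto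
qed

section \<open>Homogeneous perturbations of the linear centre\<close>

text \<open>
  As the coefficient of \<open>cnj x ^ d\<close> vanishes, \<open>x\<close> divides \<open>P(x, cnj x)\<close>; the index of the quotient is
  shifted by one.
\<close>

lemma hom_perturbation_on_real_plane:
  assumes "cnj \<xi> = - \<xi>"
    and "p 0 (Suc n) = 0"
  shows "hom_perturbation \<xi> (Suc n) p (x, cnj x) =
    (let v = x * (\<xi> + homogeneous_form n (\<lambda>j. p (Suc j) (n - j)) x) in (v, cnj v))"
proof -
  define P where "P = (\<Sum>i=0..Suc n. p i (Suc n - i) * x ^ i * cnj x ^ (Suc n - i))"
  have "P = (\<Sum>i\<le>Suc n. p i (Suc n - i) * x ^ i * cnj x ^ (Suc n - i))"
    unfolding P_def by (simp add: atLeast0AtMost)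
  also have "\<dots> = x * homogeneous_form n (\<lambda>j. p (Suc j) (n - j)) x"
    unfolding sum.atMost_Suc_shift homogeneous_form_def sum_distrib_left
    by (simp add: assms(2) mult_ac)
  finally have P: "P = x * homogeneous_form n (\<lambda>j. p (Suc j) (n - j)) x" .
  have "(\<Sum>i=0..Suc n. cnj (p (Suc n - i) i) * x ^ i * cnj x ^ (Suc n - i)) =
      (\<Sum>i=0..Suc n. cnj (p i (Suc n - i)) * cnj x ^ i * x ^ (Suc n - i))"
    by (rule sum.reindex_bij_witness[of _ "\<lambda>i. Suc n - i" "\<lambda>i. Suc n - i"])
      (auto simp: mult_ac)
  also have "\<dots> = cnj P"
    by (simp add: P_def del: sum.atLeast0_atMost_Suc sum.cl_ivl_Suc)
  finally have "hom_perturbation \<xi> (Suc n) p (x, cnj x) = (\<xi> * x + P, - \<xi> * cnj x + cnj P)"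
    unfolding hom_perturbation_def P_def by (simp only: prod.case)
  then show ?thesis
    unfolding P by (simp add: assms(1) Let_def algebra_simps)
qed

theorem lemma7:
  fixes d :: nat and \<xi> :: complex and p :: "nat \<Rightarrow> nat \<Rightarrow> complex"
  assumes "d \<ge> 2"
    and "\<xi>\<^sup>2 = -1"
    and "p 0 d = 0"
    and "\<forall>i\<in>{1..d}. p i (d - i) = cnj (p (d - i + 1) (i - 1))"
    and "\<forall>m. d = 2 * m + 1 \<longrightarrow> p (m + 1) m = 0"
  shows "isochronous (hom_perturbation \<xi> d p)"
proof -
  obtain n where d: "d = Suc n" and "n > 0"
    using \<open>d \<ge> 2\<close> by (cases d) auto
  define q where "q = (\<lambda>j. p (Suc j) (n - j))"
  define Q where "Q = (\<lambda>x. Re (homogeneous_form n q x))"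
  define C where "C = 2 * (\<Sum>j\<le>n. norm (q j))"
  \<comment> \<open>Here the primitive \<open>H\<close>, which is bounded by \<open>C * norm x ^ n\<close>, satisfies \<open>n * H < 1\<close>.\<close>
  define V where "V = {x :: complex. n * (C * norm x ^ n) < 1}"
  have "q j = cnj (q (n - j))" if "j \<le> n" for j
    using assms(4)[rule_format, of "Suc j"] that by (simp add: q_def d)
  then have real: "of_real (Q x) = homogeneous_form n q x" for x
    unfolding Q_def by (rule homogeneous_form_real)
  have mean: "q j = 0" if "2 * j = n" for j
  proof -
    have "n - j = j" "d = 2 * j + 1"
      using that d by auto
    then show ?thesis
      using assms(5) by (simp add: q_def)
  qed
  have "cnj \<xi> = - \<xi>"
    using square_eq_minus_one_cases[OF assms(2)] by auto
  show ?thesis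
  proof (rule isochronous_if_periodic_primitive[OF assms(2) \<open>n > 0\<close>, where Q = Q and V = V])
    show "continuous_on UNIV Q"
      unfolding Q_def homogeneous_form_def by (intro continuous_intros)
    show "Q (of_real r * x) = r ^ n * Q x" for r x
      by (simp add: Q_def homogeneous_form_scale del: of_real_power)
    show "hom_perturbation \<xi> d p (x, cnj x) = (x * (\<xi> + Q x), cnj (x * (\<xi> + Q x)))" for x
      using hom_perturbation_on_real_plane[of \<xi> p n x] \<open>cnj \<xi> = - \<xi>\<close> assms(3)
      by (simp only: d real q_def Let_def)
    show "open V"
      unfolding V_def by (intro open_Collect_less continuous_intros)
    show "0 \<in> V"
      using \<open>n > 0\<close> by (simp add: V_def zero_power)
    fix x
    assume "x \<in> V"
    obtain H where H: "H 0 = 0" "\<forall>t. (H has_real_derivative Q (exp (\<xi> * of_real t) * x)) (at t)"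
      "\<forall>t. H (t + 2 * pi) = H t" "\<forall>t. \<bar>H t\<bar> \<le> C * norm x ^ n"
      using homogeneous_form_periodic_primitive[where q = q and x = x, OF assms(2) mean] unfolding Q_def C_def by blast
    have "n * H t < 1" for t
    proof -
      have "n * H t \<le> n * (C * norm x ^ n)"
        using H(4) by (intro mult_left_mono) (auto simp: abs_le_iff)
      then show ?thesis
        using \<open>x \<in> V\<close> by (simp add: V_def)
    qed
    with H show "\<exists>H. H 0 = 0 \<and>
        (\<forall>t. (H has_real_derivative Q (exp (\<xi> * of_real t) * x)) (at t)) \<and>
        (\<forall>t. H (t + 2 * pi) = H t) \<and> (\<forall>t. real n * H t < 1)"
      by blast
  qed
qed

end
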